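(* Let $X$ be (the vertex set of) a transient connected infinite graph with bounded vertex degree, and let $o\in X$ be fixed. Let $G:X\to(0,\infty)$, $G(x):=G(x,o)$, be the positive minimal Green function with pole at $o$, and assume that $G$ is proper, i.e. $G^{-1}(I)$ is finite for every compact $I\subseteq(0,\infty)$. Define $$w(x):=\frac{\Delta\big(G^{1/2}\big)(x)}{G(x)^{1/2}},\qquad x\in X.$$ Then for all finitely supported functions $\varphi:X\to\mathbb{R}$, $$h(\varphi):=\frac12\sum_{\substack{(x,y)\in X\times X\\ x\sim y}}(\varphi(x)-\varphi(y))^2\;\ge\;\sum_{x\in X}w(x)\varphi(x)^2,$$ the function $w$ is an optimal Hardy-weight for $h$ in $X$, and for all $x\neq o$ $$w(x)=\frac{1}{2G(x)}\sum_{y\sim x}\left(G(x)^{1/2}-G(y)^{1/2}\right)^2 .$$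
   Context: Graphs here are simple, undirected, with standard weights: $X$ is a countably infinite vertex set, $x\sim y$ means that $x,y$ are joined by an edge, and $\deg(x)$ is the number of neighbours of $x$; bounded degree means $\sup_x\deg(x)<\infty$. For $f:X\to\mathbb{R}$, $\Delta f(x):=\sum_{y\sim x}(f(x)-f(y))$. The Green function is $G(x,y):=\sum_{n=0}^\infty p_n(x,y)$, where $p_n(x,y)$ are the matrix elements of the $n$-th power of the transition matrix with $p_1(x,y)=1/\deg(x)$ if $x\sim y$ and $p_1(x,y)=0$ otherwise. The graph is transient if the sum converges for all $x,y\in X$. $C(W)$ is the space of real functions on $W\subseteq X$ and $C_c(W)$ the subspace of finitely supported ones, both regarded as subspaces of $C(X)$ by extension by zero. A function is called positive if it is $\ge0$ and not identically $0$. For $w:X\to\mathbb{R}$ we also write $w(\varphi):=\sum_{x\in X}w(x)\varphi(x)^2$ for the associated quadratic form on $C_c(X)$. Optimal Hardy-weight. Let $w:X\to[0,\infty)$ be positive with $h-w\ge0$ on $C_c(X)$. * $h-w$ is critical in $X$ if there is no positive $\tilde w\in C(X)$ with $h-w-\tilde w\ge0$ on $C_c(X)$. In this case there is a unique (up to constant multiples) positive function $\psi$ with $\Delta\psi-w\psi\ge0$ on $X$; it is strictly positive and satisfies $\Delta\psi-w\psi=0$, and is called the ground state of $h-w$. * $h-w$ is null-critical in $X$ with respect to $w$ if it is critical in $X$ and $\sum_X\psi^2w=\infty$, where $\psi$ is the ground state. * $w$ is optimal near infinity for $h$ if for every $\lambda>0$ and every finite $W\subseteq X$ the inequality $h-w\ge\lambda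 w$ fails to hold on $C_c(X\setminus W)$. $w$ is an optimal Hardy-weight for $h$ in $X$ if $h-w$ is critical in $X$, null-critical in $X$ with respect to $w$, and $w$ is optimal near infinity for $h$. *)

theory Defs
  imports "HOL-Analysis.Analysis"
begin

text \<open>
  The vertex set is the whole type \<open>'a\<close>; a graph is given by its adjacency relation.
\<close>

definition simple_graph :: "('a \<Rightarrow> 'a \<Rightarrow> bool) \<Rightarrow> bool" where
  "simple_graph adj \<longleftrightarrow> symp adj \<and> irreflp adj"

definition connected_graph :: "('a \<Rightarrow> 'a \<Rightarrow> bool) \<Rightarrow> bool" where
  "connected_graph adj \<longleftrightarrow> (\<forall>x y. adj\<^sup>*\<^sup>* x y)"

definition nbrs :: "('a \<Rightarrow> 'a \<Rightarrow> bool) \<Rightarrow> 'a \<Rightarrow> 'a set" where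
  "nbrs adj x = {y. adj x y}"

definition deg :: "('a \<Rightarrow> 'a \<Rightarrow> bool) \<Rightarrow> 'a \<Rightarrow> nat" where
  "deg adj x = card (nbrs adj x)"

text \<open>Finiteness is required separately because the cardinality of an infinite set is 0.\<close>

definition bounded_degree :: "('a \<Rightarrow> 'a \<Rightarrow> bool) \<Rightarrow> bool" where
  "bounded_degree adj \<longleftrightarrow> (\<exists>D. \<forall>x. finite (nbrs adj x) \<and> deg adj x \<le> D)"

definition laplacian :: "('a \<Rightarrow> 'a \<Rightarrow> bool) \<Rightarrow> ('a \<Rightarrow> real) \<Rightarrow> 'a \<Rightarrow> real" where
  "laplacian adj f x = (\<Sum>y\<in>nbrs adj x. f x - f y)"

definition trans_prob :: "('a \<Rightarrow> 'a \<Rightarrow> bool) \<Rightarrow> 'a \<Rightarrow> 'a \<Rightarrow> real" where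
  "trans_prob adj x y = (if adj x y then 1 / real (deg adj x) else 0)"

text \<open>
  Powers of the transition matrix. The matrix product need only run over the neighbours of
  \<open>x\<close>, as all other entries of row \<open>x\<close> vanish.
\<close>

primrec step_prob :: "('a \<Rightarrow> 'a \<Rightarrow> bool) \<Rightarrow> nat \<Rightarrow> 'a \<Rightarrow> 'a \<Rightarrow> real" where
  "step_prob adj 0 x y = (if x = y then 1 else 0)"
| "step_prob adj (Suc n) x y = (\<Sum>z\<in>nbrs adj x. trans_prob adj x z * step_prob adj n z y)"

definition transient :: "('a \<Rightarrow> 'a \<Rightarrow> bool) \<Rightarrow> bool" where
  "transient adj \<longleftrightarrow> (\<forall>x y. summable (\<lambda>n. step_prob adj n x y))"

definition green :: "('a \<Rightarrow> 'a \<Rightarrow> bool) \<Rightarrow> 'a \<Rightarrow> 'a \<Rightarrow> real" where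
  "green adj x y = (\<Sum>n. step_prob adj n x y)"

text \<open>Properness of a function with values in the open half-line \<open>(0,\<infinity>)\<close>.\<close>

definition proper_pos :: "('a \<Rightarrow> real) \<Rightarrow> bool" where
  "proper_pos f \<longleftrightarrow> (\<forall>I. compact I \<and> I \<subseteq> {0<..} \<longrightarrow> finite (f -` I))"

text \<open>Finitely supported functions on \<open>W\<close>, extended by zero.\<close>

definition Cc :: "'a set \<Rightarrow> ('a \<Rightarrow> real) set" where
  "Cc W = {\<phi>. finite {x. \<phi> x \<noteq> 0} \<and> (\<forall>x. x \<notin> W \<longrightarrow> \<phi> x = 0)}"

text \<open>Nonnegative and not identically zero (not pointwise strictly positive).\<close>

definition pos_fun :: "('a \<Rightarrow> real) \<Rightarrow> bool" where
  "pos_fun f \<longleftrightarrow> (\<forall>x. f x \<ge> 0) \<and> (\<exists>x. f x \<noteq> 0)"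

text \<open>
  On finitely supported functions over a graph of bounded degree, both infinite sums below
  have only finitely many nonzero terms.
\<close>

definition energy :: "('a \<Rightarrow> 'a \<Rightarrow> bool) \<Rightarrow> ('a \<Rightarrow> real) \<Rightarrow> real" where
  "energy adj \<phi> = 1 / 2 * (\<Sum>\<^sub>\<infinity>(x, y)\<in>{(x, y). adj x y}. (\<phi> x - \<phi> y)\<^sup>2)"

definition wform :: "('a \<Rightarrow> real) \<Rightarrow> ('a \<Rightarrow> real) \<Rightarrow> real" where
  "wform w \<phi> = (\<Sum>\<^sub>\<infinity>x\<in>UNIV. w x * (\<phi> x)\<^sup>2)"

definition hardy_weight :: "('a \<Rightarrow> 'a \<Rightarrow> bool) \<Rightarrow> ('a \<Rightarrow> real) \<Rightarrow> bool" where
  "hardy_weight adj w \<longleftrightarrow> pos_fun w \<and> (\<forall>\<phi>\<in>Cc UNIV. energy adj \<phi> - wform w \<phi> \<ge> 0)"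

definition critical :: "('a \<Rightarrow> 'a \<Rightarrow> bool) \<Rightarrow> ('a \<Rightarrow> real) \<Rightarrow> bool" where
  "critical adj w \<longleftrightarrow>
    \<not> (\<exists>w'. pos_fun w' \<and> (\<forall>\<phi>\<in>Cc UNIV. energy adj \<phi> - wform w \<phi> - wform w' \<phi> \<ge> 0))"

definition pos_supersolution ::
    "('a \<Rightarrow> 'a \<Rightarrow> bool) \<Rightarrow> ('a \<Rightarrow> real) \<Rightarrow> ('a \<Rightarrow> real) \<Rightarrow> bool" where
  "pos_supersolution adj w \<psi> \<longleftrightarrow>
    pos_fun \<psi> \<and> (\<forall>x. laplacian adj \<psi> x - w x * \<psi> x \<ge> 0)"

text \<open>
  The ground state is the positive supersolution that is unique up to constant multiples.
\<close>

definition ground_state ::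
    "('a \<Rightarrow> 'a \<Rightarrow> bool) \<Rightarrow> ('a \<Rightarrow> real) \<Rightarrow> ('a \<Rightarrow> real) \<Rightarrow> bool" where
  "ground_state adj w \<psi> \<longleftrightarrow>
    pos_supersolution adj w \<psi> \<and>
    (\<forall>\<psi>'. pos_supersolution adj w \<psi>' \<longrightarrow> (\<exists>c. \<forall>x. \<psi>' x = c * \<psi> x))"

definition null_critical :: "('a \<Rightarrow> 'a \<Rightarrow> bool) \<Rightarrow> ('a \<Rightarrow> real) \<Rightarrow> bool" where
  "null_critical adj w \<longleftrightarrow>
    critical adj w \<and>
    (\<exists>\<psi>. ground_state adj w \<psi> \<and> (\<Sum>\<^sub>\<infinity>x\<in>UNIV. ennreal ((\<psi> x)\<^sup>2 * w x)) = \<infinity>)"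

definition optimal_near_infinity :: "('a \<Rightarrow> 'a \<Rightarrow> bool) \<Rightarrow> ('a \<Rightarrow> real) \<Rightarrow> bool" where
  "optimal_near_infinity adj w \<longleftrightarrow>
    (\<forall>l>0. \<forall>W. finite W \<longrightarrow>
      \<not> (\<forall>\<phi>\<in>Cc (- W). energy adj \<phi> - wform w \<phi> \<ge> l * wform w \<phi>))"

definition optimal_hardy_weight :: "('a \<Rightarrow> 'a \<Rightarrow> bool) \<Rightarrow> ('a \<Rightarrow> real) \<Rightarrow> bool" where
  "optimal_hardy_weight adj w \<longleftrightarrow>
    hardy_weight adj w \<and> critical adj w \<and> null_critical adj w \<and> optimal_near_infinity adj w"

end

theory Submission
  imports Defs
begin

text \<open>
  Write \<open>v = \<surd>G\<close>. Substituting \<open>\<phi> = v \<eta>\<close> turns \<open>h - w\<close> into the nonnegative form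
  \<open>Q \<eta> = 1/2 \<Sum> v x v y (\<eta> x - \<eta> y)\<^sup>2\<close>, whose sum is over ordered pairs of neighbours; this is the
  Hardy inequality. Let \<open>\<eta>\<close> be the function of \<open>G\<close> which is 0 for \<open>G \<le> a\<close>, 1 for \<open>G \<ge> b\<close> and
  logarithmic in between. Then \<open>Q \<eta>\<close> is at most a multiple of
  \<open>1/2 \<Sum> (G x - G y) (\<eta> x - \<eta> y) / ln (b/a)\<close>, and since \<open>G\<close> is harmonic off its pole, Green's
  formula bounds this by a multiple of \<open>1 / ln (b/a)\<close>. Letting \<open>a\<close> tend to 0 for fixed \<open>b\<close> gives
  a null sequence, hence criticality and the uniqueness of the ground state \<open>v\<close>. Reading Green's
  formula from below, with comparability of \<open>G\<close> at neighbouring vertices, yields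
  \<open>\<Sum> v\<^sup>2 w \<ge> C ln (b/a)\<close> for every \<open>a\<close>, hence null-criticality. Finally the difference of two such
  cutoffs is supported near infinity, has bounded \<open>Q\<close>, and equals 1 on arbitrarily large finite
  sets near infinity; so null-criticality excludes \<open>h - w \<ge> \<lambda> w\<close> there.
\<close>

section \<open>Quadratic forms on locally finite graphs\<close>

lemma wform_eq_sum:
  assumes "finite A" and "\<And>x. x \<notin> A \<Longrightarrow> \<phi> x = 0"
  shows "wform w \<phi> = (\<Sum>x\<in>A. w x * (\<phi> x)\<^sup>2)"
proof -
  have "wform w \<phi> = (\<Sum>\<^sub>\<infinity>x\<in>A. w x * (\<phi> x)\<^sup>2)"
    unfolding wform_def by (rule infsum_cong_neutral) (use assms in auto)
  then show ?thesis using assms by simp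
qed

text \<open>This sums \<open>s * (s - t) = (s - t)^2 / 2 + (s^2 - t^2) / 2\<close> over the
  neighbours, with \<open>s\<close>, \<open>t\<close> the roots of \<open>f x\<close>,
  \<open>f y\<close>. Where \<open>f\<close> is harmonic only the squares remain.\<close>

lemma laplacian_sqrt:
  assumes "\<And>x. f x \<ge> 0"
  shows "sqrt (f x) * laplacian adj (\<lambda>y. sqrt (f y)) x
    = (\<Sum>y\<in>nbrs adj x. (sqrt (f x) - sqrt (f y))\<^sup>2) / 2 + laplacian adj f x / 2"
proof -
  have "sqrt (f x) * (sqrt (f x) - sqrt (f y)) = (sqrt (f x) - sqrt (f y))\<^sup>2 / 2 + (f x - f y) / 2" for y
  proof -
    have "f x = (sqrt (f x))\<^sup>2" "f y = (sqrt (f y))\<^sup>2" using assms by auto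
    then have "(f x - f y) / 2 = ((sqrt (f x))\<^sup>2 - (sqrt (f y))\<^sup>2) / 2" by presburger
    then show ?thesis by (simp only:) (simp add: power2_eq_square algebra_simps add_divide_distrib diff_divide_distrib)
  qed
  then show ?thesis
    unfolding laplacian_def sum_distrib_left sum_divide_distrib sum.distrib[symmetric] by simp
qed

locale locally_finite_graph =
  fixes adj :: "'a \<Rightarrow> 'a \<Rightarrow> bool"
  assumes symp_adj: "symp adj" and finite_nbrs: "finite (nbrs adj x)"
begin

text \<open>Ordered pairs, hence the factor 1/2 in the sums below. One endpoint in \<open>A\<close>
  suffices, so no nonzero difference of a function supported in \<open>A\<close> is lost.\<close>

definition edges_at :: "'a set \<Rightarrow> ('a \<times> 'a) set" where
  "edges_at A = {(x, y). adj x y \<and> (x \<in> A \<or> y \<in> A)}"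

lemma finite_edges_at:
  assumes "finite A"
  shows "finite (edges_at A)"
proof (rule finite_subset)
  show "edges_at A \<subseteq> Sigma A (nbrs adj) \<union> prod.swap ` Sigma A (nbrs adj)"
    using symp_adj by (force simp: edges_at_def nbrs_def symp_def)
  show "finite (Sigma A (nbrs adj) \<union> prod.swap ` Sigma A (nbrs adj))"
    using assms finite_nbrs by auto
qed

lemma sum_edges_at_swap: "(\<Sum>(x, y)\<in>edges_at A. g y x) = (\<Sum>(x, y)\<in>edges_at A. g x y)"
  by (rule sum.reindex_bij_witness[where i = prod.swap and j = prod.swap])
    (use symp_adj in \<open>auto simp: edges_at_def symp_def\<close>)

lemma sum_edges_at_fst:
  assumes "finite A" and "\<And>x y. x \<notin> A \<Longrightarrow> g x y = 0"
  shows "(\<Sum>(x, y)\<in>edges_at A. g x y) = (\<Sum>x\<in>A. \<Sum>y\<in>nbrs adj x. g x y)"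
proof -
  have "(\<Sum>(x, y)\<in>edges_at A. g x y) = (\<Sum>(x, y)\<in>Sigma A (nbrs adj). g x y)"
    by (rule sum.mono_neutral_right)
      (use assms finite_edges_at in \<open>auto simp: edges_at_def nbrs_def\<close>)
  then show ?thesis using assms finite_nbrs by (simp add: sum.Sigma)
qed

text \<open>Summation by parts: splitting \<open>f x - f y\<close> gives two sums that agree by the
  symmetry of \<open>edges_at A\<close>, and each collapses to rows in \<open>A\<close>.\<close>

lemma green_formula:
  fixes u f :: "'a \<Rightarrow> real"
  assumes "finite A" and "\<And>x. x \<notin> A \<Longrightarrow> f x = 0"
  shows "(\<Sum>(x, y)\<in>edges_at A. (u x - u y) * (f x - f y)) / 2 = (\<Sum>x\<in>A. laplacian adj u x * f x)"
proof -
  have "(\<Sum>(x, y)\<in>edges_at A. (u x - u y) * (f x - f y))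
      = (\<Sum>(x, y)\<in>edges_at A. (u x - u y) * f x) + (\<Sum>(x, y)\<in>edges_at A. (u y - u x) * f y)"
    unfolding sum.distrib[symmetric] by (rule sum.cong) (auto simp: algebra_simps)
  also have "(\<Sum>(x, y)\<in>edges_at A. (u y - u x) * f y) = (\<Sum>(x, y)\<in>edges_at A. (u x - u y) * f x)"
    by (rule sum_edges_at_swap)
  also have "(\<Sum>(x, y)\<in>edges_at A. (u x - u y) * f x) = (\<Sum>x\<in>A. laplacian adj u x * f x)"
    using assms by (simp add: sum_edges_at_fst laplacian_def sum_distrib_right)
  finally show ?thesis by simp
qed

lemma energy_eq_sum:
  assumes "finite A" and "\<And>x. x \<notin> A \<Longrightarrow> \<phi> x = 0"
  shows "energy adj \<phi> = (\<Sum>(x, y)\<in>edges_at A. (\<phi> x - \<phi> y)\<^sup>2) / 2"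
proof -
  have "(\<Sum>\<^sub>\<infinity>(x, y)\<in>{(x, y). adj x y}. (\<phi> x - \<phi> y)\<^sup>2) = (\<Sum>\<^sub>\<infinity>(x, y)\<in>edges_at A. (\<phi> x - \<phi> y)\<^sup>2)"
    by (rule infsum_cong_neutral) (use assms(2) in \<open>force simp: edges_at_def\<close>)+
  then show ?thesis using finite_edges_at[OF assms(1)] by (simp add: energy_def)
qed

text \<open>The pointwise identity \<open>pw\<close> separates a nonnegative square from a term to
  which Green's formula applies with \<open>u = s\<close> and
  \<open>f x = (\<phi> x)^2 / s x\<close>.\<close>

lemma ground_state_representation:
  assumes "finite A" and "\<And>x. x \<notin> A \<Longrightarrow> \<phi> x = 0" and s: "\<And>x. s x > 0"
  shows "energy adj \<phi> = (\<Sum>x\<in>A. laplacian adj s x / s x * (\<phi> x)\<^sup>2)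
    + (\<Sum>(x, y)\<in>edges_at A. s x * s y * (\<phi> x / s x - \<phi> y / s y)\<^sup>2) / 2"
proof -
  have pw: "(\<phi> x - \<phi> y)\<^sup>2 = (s x - s y) * ((\<phi> x)\<^sup>2 / s x - (\<phi> y)\<^sup>2 / s y)
      + s x * s y * (\<phi> x / s x - \<phi> y / s y)\<^sup>2" for x y
    using s[of x] s[of y] by (simp add: field_simps power2_eq_square)
  have "energy adj \<phi> = (\<Sum>(x, y)\<in>edges_at A. (\<phi> x - \<phi> y)\<^sup>2) / 2"
    using assms(1,2) by (rule energy_eq_sum)
  also have "\<dots> = (\<Sum>(x, y)\<in>edges_at A. (s x - s y) * ((\<phi> x)\<^sup>2 / s x - (\<phi> y)\<^sup>2 / s y)) / 2
      + (\<Sum>(x, y)\<in>edges_at A. s x * s y * (\<phi> x / s x - \<phi> y / s y)\<^sup>2) / 2"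
    unfolding pw case_prod_beta sum.distrib add_divide_distrib ..
  finally show ?thesis using assms by (simp add: green_formula)
qed

text \<open>A supersolution satisfies \<open>w \<le> laplacian adj s / s\<close>, so the
  representation only loses a nonnegative potential term. With \<open>s = sqrt G\<close> this yields
  the Hardy inequality, with general \<open>s\<close> the uniqueness of the ground state.\<close>

lemma form_ge_of_supersolution:
  assumes "finite A" and "\<And>x. x \<notin> A \<Longrightarrow> \<phi> x = 0" and s: "\<And>x. s x > 0"
    and super: "\<And>x. laplacian adj s x - w x * s x \<ge> 0"
  shows "energy adj \<phi> - wform w \<phi>
    \<ge> (\<Sum>(x, y)\<in>edges_at A. s x * s y * (\<phi> x / s x - \<phi> y / s y)\<^sup>2) / 2"
proof -
  have "w x \<le> laplacian adj s x / s x" for x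
    using super[of x] s[of x] by (simp add: field_simps)
  then have "wform w \<phi> \<le> (\<Sum>x\<in>A. laplacian adj s x / s x * (\<phi> x)\<^sup>2)"
    using wform_eq_sum[of A \<phi> w] assms(1,2)
    by (auto intro!: sum_mono mult_right_mono simp del: times_divide_eq_left)
  then show ?thesis using ground_state_representation[of A \<phi> s] assms(1-3) by simp
qed

text \<open>Minimum principle: at a zero the inequality forces the neighbour sum to be at most 0, so
  zeros spread along edges to the whole graph.\<close>

lemma pos_supersolution_strict_pos:
  assumes "connected_graph adj" and super: "pos_supersolution adj w s"
  shows "s x > 0"
proof (rule ccontr)
  have nonneg: "s z \<ge> 0" for z using super by (simp add: pos_supersolution_def pos_fun_def)
  assume "\<not> s x > 0"
  with nonneg[of x] have x0: "s x = 0" by simp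
  have "s y = 0" for y
  proof -
    have "adj\<^sup>*\<^sup>* x y" using assms(1) by (simp add: connected_graph_def)
    then show ?thesis
    proof (induction rule: rtranclp_induct)
      case (step y z)
      have "laplacian adj s y \<ge> 0"
        using super step.IH by (metis diff_zero mult_zero_right pos_supersolution_def)
      then have "(\<Sum>z\<in>nbrs adj y. s z) \<le> 0"
        using step.IH by (simp add: laplacian_def sum_negf)
      then have "(\<Sum>z\<in>nbrs adj y. s z) = 0" using nonneg by (meson antisym sum_nonneg)
      then show ?case
        using sum_nonneg_eq_0_iff[of "nbrs adj y" s] finite_nbrs nonneg step.hyps by (auto simp: nbrs_def)
    qed (rule x0)
  qed
  then show False using super by (simp add: pos_supersolution_def pos_fun_def)
qed

end

section \<open>Logarithmic cutoffs\<close>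

text \<open>This is \<open>ln u \<le> u - 1\<close> at \<open>u = sqrt s / sqrt t\<close>; the
  factor 2 comes from halving the logarithm.\<close>

lemma ln_diff_le_sqrt:
  fixes s t :: real
  assumes "0 < t" and "t \<le> s"
  shows "ln s - ln t \<le> 2 * (sqrt s - sqrt t) / sqrt t"
proof -
  have "ln (sqrt s / sqrt t) \<le> sqrt s / sqrt t - 1"
    using assms by (intro ln_le_minus_one) auto
  then show ?thesis using assms by (simp add: ln_div ln_sqrt field_simps)
qed

lemma sqrt_mult_ln_diff_le:
  fixes s t :: real
  assumes "0 < s" and "0 < t"
  shows "sqrt s * sqrt t * \<bar>ln s - ln t\<bar> \<le> 2 * \<bar>s - t\<bar>"
proof -
  have *: "sqrt s * sqrt t * (ln s - ln t) \<le> 2 * (s - t)" if "0 < t" "t \<le> s" for s t :: real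
  proof -
    have "sqrt s * sqrt t * (ln s - ln t) \<le> sqrt s * sqrt t * (2 * (sqrt s - sqrt t) / sqrt t)"
      using ln_diff_le_sqrt[OF that] that by (intro mult_left_mono) auto
    also have "\<dots> = 2 * sqrt s * (sqrt s - sqrt t)" using that by simp
    also have "\<dots> = 2 * (s - sqrt s * sqrt t)" using that by (simp add: algebra_simps)
    also have "\<dots> \<le> 2 * (s - t)"
      using mult_right_mono[of "sqrt t" "sqrt s" "sqrt t"] that by simp
    finally show ?thesis .
  qed
  show ?thesis
    using *[of t s] *[of s t] assms by (cases "t \<le> s") (auto simp: mult.commute)
qed

text \<open>Comparability bounds the factor \<open>(sqrt s + sqrt t) / sqrt t\<close> by
  \<open>1 + sqrt D\<close>, which turns the flux into the squares that make up the weight.\<close>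

lemma diff_mult_ln_diff_le:
  fixes s t :: real
  assumes "0 < s" "0 < t" "s \<le> D * t" "t \<le> D * s"
  shows "(s - t) * (ln s - ln t) \<le> 2 * (1 + sqrt D) * (sqrt s - sqrt t)\<^sup>2"
proof -
  have *: "(s - t) * (ln s - ln t) \<le> 2 * (1 + sqrt D) * (sqrt s - sqrt t)\<^sup>2"
    if "0 < t" "t \<le> s" "s \<le> D * t" for s t :: real
  proof -
    have st: "s - t = (sqrt s + sqrt t) * (sqrt s - sqrt t)"
      using that by (simp add: algebra_simps)
    have "sqrt s \<le> sqrt D * sqrt t" using that(3) by (metis real_sqrt_le_mono real_sqrt_mult)
    then have r: "(sqrt s + sqrt t) / sqrt t \<le> 1 + sqrt D"
      using that by (simp add: field_simps)
    have "(s - t) * (ln s - ln t) \<le> (s - t) * (2 * (sqrt s - sqrt t) / sqrt t)"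
      using ln_diff_le_sqrt[OF that(1,2)] that by (intro mult_left_mono) auto
    also have "\<dots> = 2 * ((sqrt s + sqrt t) / sqrt t) * (sqrt s - sqrt t)\<^sup>2"
      unfolding st by (simp add: power2_eq_square) (simp add: algebra_simps)
    also have "\<dots> \<le> 2 * (1 + sqrt D) * (sqrt s - sqrt t)\<^sup>2"
      by (intro mult_right_mono mult_left_mono r) auto
    finally show ?thesis .
  qed
  show ?thesis
  proof (cases "t \<le> s")
    case False
    have "(s - t) * (ln s - ln t) = (t - s) * (ln t - ln s)" by (simp add: algebra_simps)
    also have "\<dots> \<le> 2 * (1 + sqrt D) * (sqrt t - sqrt s)\<^sup>2" using * assms False by simp
    finally show ?thesis by (simp add: power2_commute)
  qed (use * assms in simp)
qed

definition log_cutoff :: "real \<Rightarrow> real \<Rightarrow> real \<Rightarrow> real" where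
  "log_cutoff a b t = max 0 (min 1 ((ln t - ln a) / (ln b - ln a)))"

lemma log_cutoff_bounds: "0 \<le> log_cutoff a b t" "log_cutoff a b t \<le> 1"
  by (auto simp: log_cutoff_def)

lemma log_cutoff_eq_0:
  assumes "0 < t" "t \<le> a" "a < b"
  shows "log_cutoff a b t = 0"
proof -
  have "(ln t - ln a) / (ln b - ln a) \<le> 0" using assms by (intro divide_nonpos_pos) auto
  then show ?thesis by (simp add: log_cutoff_def)
qed

lemma log_cutoff_eq_1:
  assumes "0 < a" "a < b" "b \<le> t"
  shows "log_cutoff a b t = 1"
  using assms by (simp add: log_cutoff_def)

lemma log_cutoff_mono:
  assumes "0 < a" "a < b" "0 < s" "s \<le> t"
  shows "log_cutoff a b s \<le> log_cutoff a b t"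
proof -
  have "(ln s - ln a) / (ln b - ln a) \<le> (ln t - ln a) / (ln b - ln a)"
    using assms by (intro divide_right_mono) auto
  then show ?thesis by (auto simp: log_cutoff_def)
qed

lemma log_cutoff_lipschitz:
  assumes "0 < a" "a < b"
  shows "\<bar>log_cutoff a b s - log_cutoff a b t\<bar> \<le> \<bar>ln s - ln t\<bar> / (ln b - ln a)"
proof -
  have "\<bar>log_cutoff a b s - log_cutoff a b t\<bar>
      \<le> \<bar>(ln s - ln a) / (ln b - ln a) - (ln t - ln a) / (ln b - ln a)\<bar>"
    unfolding log_cutoff_def by linarith
  also have "\<dots> = \<bar>(ln s - ln t) / (ln b - ln a)\<bar>"
    unfolding diff_divide_distrib[symmetric] by simp
  finally show ?thesis using assms by simp
qed

lemma diff_mult_log_cutoff_diff: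
  assumes "0 < a" "a < b" "0 < s" "0 < t"
  shows "(s - t) * (log_cutoff a b s - log_cutoff a b t)
    = \<bar>s - t\<bar> * \<bar>log_cutoff a b s - log_cutoff a b t\<bar>"
  using log_cutoff_mono[of a b s t] log_cutoff_mono[of a b t s] assms
  by (cases "s \<le> t") (auto simp: algebra_simps)

text \<open>One factor of the square is replaced by its Lipschitz bound in \<open>ln\<close>, the
  other is kept. Monotonicity of the cutoff lets the absolute values be dropped.\<close>

lemma log_cutoff_energy_density_le:
  assumes "0 < a" "a < b" "0 < s" "0 < t"
  shows "sqrt s * sqrt t * (log_cutoff a b s - log_cutoff a b t)\<^sup>2
    \<le> 2 / (ln b - ln a) * ((s - t) * (log_cutoff a b s - log_cutoff a b t))"
proof -
  let ?d = "\<bar>log_cutoff a b s - log_cutoff a b t\<bar>" and ?L = "ln b - ln a"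
  have L: "?L > 0" using assms by simp
  have "sqrt s * sqrt t * ?d\<^sup>2 \<le> sqrt s * sqrt t * (\<bar>ln s - ln t\<bar> / ?L * ?d)"
    unfolding power2_eq_square
    using log_cutoff_lipschitz[OF assms(1,2)] assms by (intro mult_left_mono mult_right_mono) auto
  also have "\<dots> = sqrt s * sqrt t * \<bar>ln s - ln t\<bar> * (?d / ?L)" by simp
  also have "\<dots> \<le> 2 * \<bar>s - t\<bar> * (?d / ?L)"
    using sqrt_mult_ln_diff_le[OF assms(3,4)] L by (intro mult_right_mono) auto
  also have "\<dots> = 2 / ?L * (\<bar>s - t\<bar> * ?d)" by simp
  finally show ?thesis using diff_mult_log_cutoff_diff[OF assms] by simp
qed

text \<open>Used for the lower bound on the weight: the flux is now the smaller side.\<close>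

lemma log_cutoff_flux_density_le:
  assumes "0 < a" "a < b" "0 < s" "0 < t" "s \<le> D * t" "t \<le> D * s"
  shows "(s - t) * (log_cutoff a b s - log_cutoff a b t)
    \<le> 2 * (1 + sqrt D) / (ln b - ln a) * (sqrt s - sqrt t)\<^sup>2"
proof -
  let ?L = "ln b - ln a"
  have L: "?L > 0" using assms by simp
  have "(s - t) * (log_cutoff a b s - log_cutoff a b t) \<le> \<bar>s - t\<bar> * (\<bar>ln s - ln t\<bar> / ?L)"
    unfolding diff_mult_log_cutoff_diff[OF assms(1-4)]
    using log_cutoff_lipschitz[OF assms(1,2)] by (intro mult_left_mono) auto
  also have "\<dots> = (s - t) * (ln s - ln t) / ?L"
    using assms by (cases "s \<le> t") (auto simp: algebra_simps)
  also have "\<dots> \<le> 2 * (1 + sqrt D) * (sqrt s - sqrt t)\<^sup>2 / ?L"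
    using diff_mult_ln_diff_le[OF assms(3-6)] L by (intro divide_right_mono) auto
  finally show ?thesis by simp
qed

section \<open>Functions harmonic off a pole\<close>

text \<open>The properties of the Green function that the argument uses. As \<open>laplacian\<close>
  is not normalised, the strength \<open>c\<close> of the pole will be its degree; \<open>D\<close>
  will be a degree bound.\<close>

locale proper_harmonic_off_pole = locally_finite_graph adj
  for adj :: "'a \<Rightarrow> 'a \<Rightarrow> bool" +
  fixes G :: "'a \<Rightarrow> real" and p :: 'a and c D :: real
  assumes connected: "connected_graph adj"
    and G_pos: "G x > 0"
    and c_pos: "c > 0"
    and laplacian_G: "laplacian adj G x = (if x = p then c else 0)"
    and finite_superlevel: "a > 0 \<Longrightarrow> finite {x. a < G x}"
    and harnack: "adj x y \<Longrightarrow> G y \<le> D * G x"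
begin

section \<open>The weight and its quadratic form\<close>

definition w :: "'a \<Rightarrow> real" where
  "w x = laplacian adj (\<lambda>y. sqrt (G y)) x / sqrt (G x)"

lemma G_mult_w: "G x * w x = (\<Sum>y\<in>nbrs adj x. (sqrt (G x) - sqrt (G y))\<^sup>2) / 2 + (if x = p then c else 0) / 2"
proof -
  have "G x * w x = sqrt (G x) * laplacian adj (\<lambda>y. sqrt (G y)) x"
    using G_pos[of x] by (simp add: w_def real_div_sqrt divide_simps flip: real_sqrt_mult)
  then show ?thesis using laplacian_sqrt[of G x adj] G_pos laplacian_G by (simp add: less_imp_le)
qed

lemma w_nonneg: "w x \<ge> 0"
proof -
  have "0 \<le> G x * w x" unfolding G_mult_w using c_pos by (auto intro!: add_nonneg_nonneg sum_nonneg)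
  then show ?thesis using G_pos[of x] by (simp add: zero_le_mult_iff)
qed

lemma laplacian_sqrt_G: "laplacian adj (\<lambda>y. sqrt (G y)) x - w x * sqrt (G x) = 0"
  using G_pos[of x] by (simp add: w_def)

lemma form_nonneg:
  assumes "\<phi> \<in> Cc UNIV"
  shows "energy adj \<phi> - wform w \<phi> \<ge> 0"
proof -
  have "0 \<le> (\<Sum>(x, y)\<in>edges_at {x. \<phi> x \<noteq> 0}. sqrt (G x) * sqrt (G y)
      * (\<phi> x / sqrt (G x) - \<phi> y / sqrt (G y))\<^sup>2) / 2"
    using G_pos by (auto intro!: sum_nonneg simp: less_imp_le)
  also have "\<dots> \<le> energy adj \<phi> - wform w \<phi>"
    by (rule form_ge_of_supersolution)
      (use assms G_pos laplacian_sqrt_G in \<open>auto simp: Cc_def\<close>)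
  finally show ?thesis .
qed

text \<open>Since \<open>sqrt G\<close> solves the equation exactly, the potential terms cancel and
  only the squares survive.\<close>

lemma form_sqrt_G:
  assumes "finite A" and "\<And>x. x \<notin> A \<Longrightarrow> \<eta> x = 0"
  shows "energy adj (\<lambda>x. sqrt (G x) * \<eta> x) - wform w (\<lambda>x. sqrt (G x) * \<eta> x)
    = (\<Sum>(x, y)\<in>edges_at A. sqrt (G x) * sqrt (G y) * (\<eta> x - \<eta> y)\<^sup>2) / 2"
proof -
  have "sqrt (G x) * \<eta> x / sqrt (G x) = \<eta> x" for x using G_pos[of x] by simp
  then show ?thesis
    using ground_state_representation[of A "\<lambda>x. sqrt (G x) * \<eta> x" "\<lambda>x. sqrt (G x)"]
      wform_eq_sum[of A "\<lambda>x. sqrt (G x) * \<eta> x" w] assms G_pos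
    by (simp add: w_def)
qed

section \<open>Cutoffs along the level sets of \<open>G\<close>\<close>

definition cutoff :: "real \<Rightarrow> real \<Rightarrow> 'a \<Rightarrow> real" where
  "cutoff a b x = log_cutoff a b (G x)"

lemma cutoff_eq_0: "a < b \<Longrightarrow> G x \<le> a \<Longrightarrow> cutoff a b x = 0"
  using G_pos by (simp add: cutoff_def log_cutoff_eq_0)

text \<open>In Green's formula with \<open>u = G\<close> only the pole contributes, so the flux is
  bounded independently of \<open>a\<close> and \<open>b\<close>.\<close>

lemma cutoff_flux:
  assumes "0 < a" "a < b" "finite A" "{x. a < G x} \<subseteq> A"
  shows "(\<Sum>(x, y)\<in>edges_at A. (G x - G y) * (cutoff a b x - cutoff a b y)) / 2 = c * cutoff a b p"
proof -
  have supp: "cutoff a b x = 0" if "x \<notin> A" for x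
    using that assms by (intro cutoff_eq_0) (auto simp: not_less[symmetric])
  have "(\<Sum>x\<in>A. laplacian adj G x * cutoff a b x) = (\<Sum>x\<in>A. if x = p then c * cutoff a b p else 0)"
    by (rule sum.cong) (auto simp: laplacian_G)
  \<comment> \<open>If the pole lies outside \<open>A\<close>, then \<open>cutoff a b p = 0\<close>
    and both sides vanish.\<close>
  also have "\<dots> = c * cutoff a b p" using supp assms(3) by (simp add: sum.delta)
  finally show ?thesis using green_formula[of A "cutoff a b" G] assms(3) supp by simp
qed

lemma cutoff_form_le:
  assumes "0 < a" "a < b" "finite A" "{x. a < G x} \<subseteq> A"
  shows "(\<Sum>(x, y)\<in>edges_at A. sqrt (G x) * sqrt (G y) * (cutoff a b x - cutoff a b y)\<^sup>2) / 2
    \<le> 2 * c / (ln b - ln a)"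
proof -
  let ?L = "ln b - ln a"
  have L: "?L > 0" using assms by simp
  have "(\<Sum>(x, y)\<in>edges_at A. sqrt (G x) * sqrt (G y) * (cutoff a b x - cutoff a b y)\<^sup>2) / 2
      \<le> (\<Sum>(x, y)\<in>edges_at A. 2 / ?L * ((G x - G y) * (cutoff a b x - cutoff a b y))) / 2"
    unfolding cutoff_def using log_cutoff_energy_density_le[OF assms(1,2) G_pos G_pos]
    by (intro divide_right_mono sum_mono) auto
  also have "\<dots> = 2 / ?L * ((\<Sum>(x, y)\<in>edges_at A. (G x - G y) * (cutoff a b x - cutoff a b y)) / 2)"
    by (simp add: case_prod_beta sum_distrib_left)
  also have "\<dots> = 2 / ?L * (c * cutoff a b p)" by (simp only: cutoff_flux[OF assms])
  also have "\<dots> \<le> 2 / ?L * (c * 1)"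
    using L c_pos by (intro mult_left_mono) (auto simp: cutoff_def log_cutoff_bounds)
  finally show ?thesis by simp
qed

text \<open>Functions of the form \<open>\<surd>G * cutoff a b\<close> with \<open>a\<close> tending to 0 are a null sequence.\<close>

lemma null_sequence:
  assumes "0 < b" "0 < e"
  obtains \<eta> A where "finite A" "\<And>x. x \<notin> A \<Longrightarrow> \<eta> x = 0" "\<And>x. b \<le> G x \<Longrightarrow> \<eta> x = 1"
    "energy adj (\<lambda>x. sqrt (G x) * \<eta> x) - wform w (\<lambda>x. sqrt (G x) * \<eta> x) < e"
proof -
  \<comment> \<open>Chosen so that the bound \<open>2 * c / (ln b - ln a)\<close> equals
    \<open>e / 2\<close>.\<close>
  define a where "a = b * exp (- (4 * c / e))"
  have pos: "4 * c / e > 0" using assms c_pos by simp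
  have a: "0 < a" "a < b" using assms pos by (auto simp: a_def)
  have L: "ln b - ln a = 4 * c / e" using assms by (simp add: a_def ln_mult)
  have supp: "cutoff a b x = 0" if "x \<notin> {x. a < G x}" for x
    using that a by (intro cutoff_eq_0) auto
  show ?thesis
  proof (rule that[of "{x. a < G x}" "cutoff a b"])
    show "finite {x. a < G x}" using a finite_superlevel by simp
    show "cutoff a b x = 1" if "b \<le> G x" for x using that a by (simp add: cutoff_def log_cutoff_eq_1)
    have "energy adj (\<lambda>x. sqrt (G x) * cutoff a b x) - wform w (\<lambda>x. sqrt (G x) * cutoff a b x)
        \<le> 2 * c / (ln b - ln a)"
      using cutoff_form_le[OF a, of "{x. a < G x}"] finite_superlevel[OF a(1)]
      by (subst form_sqrt_G[of "{x. a < G x}"]) (auto simp: supp)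
    also have "\<dots> < e" unfolding L using assms c_pos by simp
    finally show "energy adj (\<lambda>x. sqrt (G x) * cutoff a b x) - wform w (\<lambda>x. sqrt (G x) * cutoff a b x) < e" .
  qed (rule supp)
qed

section \<open>Criticality and the ground state\<close>

lemma critical: "critical adj w"
  unfolding critical_def
proof
  assume "\<exists>w'. pos_fun w' \<and> (\<forall>\<phi>\<in>Cc UNIV. energy adj \<phi> - wform w \<phi> - wform w' \<phi> \<ge> 0)"
  then obtain w' x where w': "\<And>x. w' x \<ge> 0" "w' x \<noteq> 0"
    and ineq: "\<And>\<phi>. \<phi> \<in> Cc UNIV \<Longrightarrow> energy adj \<phi> - wform w \<phi> - wform w' \<phi> \<ge> 0"
    by (auto simp: pos_fun_def)
  have pos: "w' x * G x > 0" using w'(1)[of x] w'(2) G_pos[of x] by simp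
  \<comment> \<open>The level \<open>G x\<close> makes \<open>\<eta> x = 1\<close>, so the vertex
    \<open>x\<close> alone contributes \<open>w' x * G x\<close> to \<open>wform w'\<close>, more
    than the form allows.\<close>
  obtain \<eta> A where \<eta>: "finite A" "\<And>x. x \<notin> A \<Longrightarrow> \<eta> x = 0" "\<And>y. G x \<le> G y \<Longrightarrow> \<eta> y = 1"
    "energy adj (\<lambda>x. sqrt (G x) * \<eta> x) - wform w (\<lambda>x. sqrt (G x) * \<eta> x) < w' x * G x"
    using G_pos[of x] pos by (rule null_sequence) (rule that)
  let ?\<phi> = "\<lambda>x. sqrt (G x) * \<eta> x"
  have "\<eta> x = 1" using \<eta>(3) by simp
  then have "x \<in> A" using \<eta>(2) by force
  have "w' x * G x = w' x * (?\<phi> x)\<^sup>2" using \<open>\<eta> x = 1\<close> G_pos[of x] by simp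
  also have "\<dots> \<le> wform w' ?\<phi>"
    using \<eta>(1,2) \<open>x \<in> A\<close> w'(1)
    by (subst wform_eq_sum[of A]) (auto intro!: member_le_sum[where f = "\<lambda>x. w' x * (?\<phi> x)\<^sup>2"])
  finally have "w' x * G x \<le> wform w' ?\<phi>" .
  moreover have "?\<phi> \<in> Cc UNIV"
    using finite_subset[OF _ \<eta>(1), of "{x. ?\<phi> x \<noteq> 0}"] \<eta>(2) by (auto simp: Cc_def)
  ultimately show False using ineq[of ?\<phi>] \<eta>(4) by simp
qed

text \<open>For a supersolution \<open>s\<close>, the null sequence makes the squares in the
  representation by \<open>s\<close> arbitrarily small. Hence \<open>sqrt G / s\<close> agrees
  across every edge and is constant by connectedness.\<close>

lemma ground_state: "ground_state adj w (\<lambda>x. sqrt (G x))"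
  unfolding ground_state_def
proof (intro conjI allI impI)
  have "sqrt (G p) \<noteq> 0" using G_pos[of p] by simp
  then show "pos_supersolution adj w (\<lambda>x. sqrt (G x))"
    using G_pos laplacian_sqrt_G
    by (auto simp: pos_supersolution_def pos_fun_def less_imp_le intro!: exI[of _ p])
next
  fix s assume super: "pos_supersolution adj w s"
  then have s_pos: "s x > 0" for x using connected pos_supersolution_strict_pos by blast
  have step: "sqrt (G x) / s x = sqrt (G y) / s y" if "adj x y" for x y
  proof (rule ccontr)
    assume neq: "sqrt (G x) / s x \<noteq> sqrt (G y) / s y"
    \<comment> \<open>The contribution of the pair \<open>(x, y)\<close> to the form once the cutoff
      is 1 at both ends.\<close>
    define e where "e = s x * s y * (sqrt (G x) / s x - sqrt (G y) / s y)\<^sup>2 / 2"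
    have "min (G x) (G y) > 0" using G_pos by simp
    moreover have "e > 0" using neq s_pos by (simp add: e_def)
    ultimately obtain \<eta> A where \<eta>: "finite A" "\<And>z. z \<notin> A \<Longrightarrow> \<eta> z = 0"
      "\<And>z. min (G x) (G y) \<le> G z \<Longrightarrow> \<eta> z = 1"
      "energy adj (\<lambda>x. sqrt (G x) * \<eta> x) - wform w (\<lambda>x. sqrt (G x) * \<eta> x) < e"
      by (rule null_sequence) (rule that)
    let ?g = "\<lambda>(x, y). s x * s y * (sqrt (G x) * \<eta> x / s x - sqrt (G y) * \<eta> y / s y)\<^sup>2"
    have one: "\<eta> x = 1" "\<eta> y = 1" using \<eta>(3) by auto
    then have "(x, y) \<in> edges_at A" using \<eta>(2) that by (force simp: edges_at_def)
    then have "?g (x, y) \<le> (\<Sum>e\<in>edges_at A. ?g e)"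
      using finite_edges_at[OF \<eta>(1)] s_pos by (intro member_le_sum) (auto simp: less_imp_le)
    then have "e \<le> (\<Sum>e\<in>edges_at A. ?g e) / 2" by (simp add: e_def one)
    also have "\<dots> \<le> energy adj (\<lambda>x. sqrt (G x) * \<eta> x) - wform w (\<lambda>x. sqrt (G x) * \<eta> x)"
      using super by (intro form_ge_of_supersolution \<eta>(1) s_pos)
        (auto simp: \<eta>(2) pos_supersolution_def)
    finally show False using \<eta>(4) by simp
  qed
  have quot: "sqrt (G p) / s p = sqrt (G x) / s x" for x
  proof -
    have "adj\<^sup>*\<^sup>* p x" using connected by (simp add: connected_graph_def)
    then show ?thesis by (induction rule: rtranclp_induct) (auto dest: step)
  qed
  have "s x = s p / sqrt (G p) * sqrt (G x)" for x
    using quot[of x] s_pos[of x] s_pos[of p] G_pos[of p] by (simp add: field_simps)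
  then show "\<exists>c. \<forall>x. s x = c * sqrt (G x)" by blast
qed

section \<open>Null-criticality\<close>

text \<open>A cutoff equal to 1 at the pole has flux exactly \<open>c\<close>, while its flux is at
  most \<open>K / L\<close> times a finite sum of \<open>G * w\<close>. As \<open>L\<close> is
  arbitrary, these sums are unbounded.\<close>

lemma sum_G_mult_w_unbounded:
  obtains S where "finite S" "(\<Sum>x\<in>S. G x * w x) > M"
proof -
  define K where "K = 2 * (1 + sqrt D)"
  have "K > 0"
  proof -
    \<comment> \<open>An edge is wanted because \<open>harnack\<close> along it forces
      \<open>D > 0\<close>.\<close>
    have "\<exists>x y. adj x y"
    proof (rule ccontr)
      assume "\<nexists>x y. adj x y"
      then have "laplacian adj G p = 0" by (simp add: laplacian_def nbrs_def)
      then show False using laplacian_G[of p] c_pos by simp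
    qed
    then obtain x y where "adj x y" by blast
    then have "0 < D * G x" using harnack[of x y] G_pos[of y] by linarith
    then show ?thesis using G_pos[of x] by (simp add: K_def zero_less_mult_iff add_pos_pos)
  qed
  \<comment> \<open>Solves \<open>c * L / K = \<bar>M\<bar> + 1\<close>.\<close>
  define L where "L = K * (\<bar>M\<bar> + 1) / c"
  define a b where "a = G p * exp (- L)" and "b = G p"
  have "L > 0" using \<open>K > 0\<close> c_pos by (simp add: L_def)
  then have a: "0 < a" "a < b" using G_pos[of p] by (auto simp: a_def b_def)
  have L: "ln b - ln a = L" using G_pos[of p] by (simp add: a_def b_def ln_mult)
  define A where "A = {x. a < G x}"
  have A: "finite A" using a finite_superlevel by (simp add: A_def)
  \<comment> \<open>Includes the neighbours of \<open>A\<close>, so that every pair in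
    \<open>edges_at A\<close> is counted in the row of its first vertex.\<close>
  define S where "S = fst ` edges_at A"
  have S: "finite S" using finite_edges_at[OF A] by (simp add: S_def)
  have "c = c * cutoff a b p" using a by (simp add: cutoff_def b_def log_cutoff_eq_1)
  also have "\<dots> = (\<Sum>(x, y)\<in>edges_at A. (G x - G y) * (cutoff a b x - cutoff a b y)) / 2"
    using cutoff_flux[OF a A] by (simp add: A_def)
  also have "\<dots> \<le> (\<Sum>(x, y)\<in>edges_at A. K / L * (sqrt (G x) - sqrt (G y))\<^sup>2) / 2"
  proof -
    have "(G x - G y) * (cutoff a b x - cutoff a b y) \<le> K / L * (sqrt (G x) - sqrt (G y))\<^sup>2" if "adj x y" for x y
      unfolding cutoff_def K_def L[symmetric] using that symp_adj
      by (intro log_cutoff_flux_density_le a G_pos harnack) (auto simp: symp_def)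
    then show ?thesis by (intro divide_right_mono sum_mono) (auto simp: edges_at_def)
  qed
  also have "\<dots> \<le> (\<Sum>(x, y)\<in>Sigma S (nbrs adj). K / L * (sqrt (G x) - sqrt (G y))\<^sup>2) / 2"
    using S finite_nbrs \<open>K > 0\<close> \<open>L > 0\<close>
    by (intro divide_right_mono sum_mono2) (force simp: S_def edges_at_def nbrs_def)+
  also have "\<dots> = K / L * (\<Sum>x\<in>S. (\<Sum>y\<in>nbrs adj x. (sqrt (G x) - sqrt (G y))\<^sup>2) / 2)"
    using S finite_nbrs
    by (simp add: sum.Sigma[symmetric] sum_distrib_left[symmetric] sum_divide_distrib[symmetric])
  also have "\<dots> \<le> K / L * (\<Sum>x\<in>S. G x * w x)"
    using c_pos \<open>K > 0\<close> \<open>L > 0\<close> by (intro mult_left_mono sum_mono) (auto simp: G_mult_w)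
  finally have "c * L \<le> K * (\<Sum>x\<in>S. G x * w x)" using \<open>L > 0\<close> by (simp add: field_simps)
  then have "K * (\<bar>M\<bar> + 1) \<le> K * (\<Sum>x\<in>S. G x * w x)" using c_pos by (simp add: L_def)
  then have "\<bar>M\<bar> + 1 \<le> (\<Sum>x\<in>S. G x * w x)" using \<open>K > 0\<close> by simp
  then show ?thesis using S by (intro that[of S]) auto
qed

lemma hardy_weight: "hardy_weight adj w"
proof -
  obtain S where S: "(\<Sum>x\<in>S. G x * w x) > 0" by (rule sum_G_mult_w_unbounded)
  have "\<exists>x. w x \<noteq> 0"
  proof (rule ccontr)
    assume "\<nexists>x. w x \<noteq> 0"
    then show False using S by simp
  qed
  then show ?thesis using w_nonneg form_nonneg by (auto simp: hardy_weight_def pos_fun_def)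
qed

lemma null_critical: "null_critical adj w"
proof -
  have "(\<Sum>\<^sub>\<infinity>x\<in>UNIV. ennreal ((sqrt (G x))\<^sup>2 * w x)) = \<infinity>" (is "?I = _")
  proof (rule ccontr)
    assume "?I \<noteq> \<infinity>"
    then obtain r where r: "?I = ennreal r" "r \<ge> 0" by (cases ?I) auto
    obtain S where S: "finite S" "(\<Sum>x\<in>S. G x * w x) > r" by (rule sum_G_mult_w_unbounded)
    have "ennreal (\<Sum>x\<in>S. G x * w x) = (\<Sum>x\<in>S. ennreal ((sqrt (G x))\<^sup>2 * w x))"
      using w_nonneg G_pos by (simp add: less_imp_le)
    also have "\<dots> \<le> ?I"
      using S(1) by (subst nonneg_infsum_complete) (auto intro!: SUP_upper)
    finally have "(\<Sum>x\<in>S. G x * w x) \<le> r" using r by simp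
    then show False using S(2) by simp
  qed
  then show ?thesis using critical ground_state by (auto simp: null_critical_def)
qed

section \<open>Optimality near infinity\<close>

lemma optimal_near_infinity: "optimal_near_infinity adj w"
  unfolding optimal_near_infinity_def
proof (intro allI impI notI)
  fix l :: real and W :: "'a set"
  assume "l > 0" and W: "finite W"
    and ineq: "\<forall>\<phi>\<in>Cc (- W). energy adj \<phi> - wform w \<phi> \<ge> l * wform w \<phi>"
  \<comment> \<open>The 1 covers empty \<open>W\<close>. Both cutoffs below equal 1 on
    \<open>W\<close>, so their difference vanishes there.\<close>
  define d where "d = Min (insert 1 (G ` W))"
  have d: "d > 0" "\<And>x. x \<in> W \<Longrightarrow> d \<le> G x" using W G_pos by (auto simp: d_def)
  define B where "B = {x. d / 2 < G x}"
  have B: "finite B" using d(1) finite_superlevel[of "d / 2"] by (simp add: B_def)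
  \<comment> \<open>Outside \<open>B\<close> the second cutoff is 0. The excess over the sum on
    \<open>B\<close> is the upper bound for \<open>wform\<close> derived below from
    \<open>ineq\<close>, which does not depend on \<open>S\<close>.\<close>
  obtain S where S: "finite S"
    and S_large: "(\<Sum>x\<in>S. G x * w x) > (\<Sum>x\<in>B. G x * w x) + 8 * c / ln 2 / l"
    by (rule sum_G_mult_w_unbounded)
  \<comment> \<open>Low enough for the first cutoff to be 1 on \<open>S\<close>, and below
    \<open>d\<close> so that it is also 1 on \<open>W\<close>.\<close>
  define b where "b = Min (insert (d / 2) (G ` S))"
  have b: "b > 0" "b \<le> d / 2" "\<And>x. x \<in> S \<Longrightarrow> b \<le> G x"
    using S d(1) G_pos Min_le[of "insert (d / 2) (G ` S)" "d / 2"] by (auto simp: b_def)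
  define A where "A = {x. b / 2 < G x}"
  have A: "finite A" using b(1) finite_superlevel[of "b / 2"] by (simp add: A_def)
  define \<eta> where "\<eta> x = cutoff (b / 2) b x - cutoff (d / 2) d x" for x
  have supp: "\<eta> x = 0" if "x \<notin> A" for x
    using that b d(1) cutoff_eq_0[of "b / 2" b x] cutoff_eq_0[of "d / 2" d x]
    by (auto simp: A_def \<eta>_def)
  have \<eta>_W: "\<eta> x = 0" if "x \<in> W" for x
    using d(1) d(2)[OF that] b by (simp add: \<eta>_def cutoff_def log_cutoff_eq_1)
  have \<eta>_S: "\<eta> x = 1" if "x \<in> S - B" for x
    using that b(1) b(3)[of x] cutoff_eq_0[of "d / 2" d x] d(1)
    by (auto simp: B_def \<eta>_def cutoff_def log_cutoff_eq_1)
  let ?\<phi> = "\<lambda>x. sqrt (G x) * \<eta> x"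
  let ?Q = "\<lambda>\<eta>. (\<Sum>(x, y)\<in>edges_at A. sqrt (G x) * sqrt (G y) * (\<eta> x - \<eta> y)\<^sup>2) / 2"
  have Q_diff: "?Q (\<lambda>x. f x - g x) \<le> 2 * ?Q f + 2 * ?Q g" for f g
  proof -
    have "sqrt (G x) * sqrt (G y) * ((f x - g x) - (f y - g y))\<^sup>2
      \<le> 2 * (sqrt (G x) * sqrt (G y) * (f x - f y)\<^sup>2) + 2 * (sqrt (G x) * sqrt (G y) * (g x - g y)\<^sup>2)" for x y
    proof -
      have "((f x - g x) - (f y - g y))\<^sup>2 \<le> 2 * (f x - f y)\<^sup>2 + 2 * (g x - g y)\<^sup>2"
        using zero_le_power2[of "(f x - f y) + (g x - g y)"] by (simp add: power2_eq_square algebra_simps)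
      then have "sqrt (G x) * sqrt (G y) * ((f x - g x) - (f y - g y))\<^sup>2
          \<le> sqrt (G x) * sqrt (G y) * (2 * (f x - f y)\<^sup>2 + 2 * (g x - g y)\<^sup>2)"
        using G_pos by (intro mult_left_mono) (auto simp: less_imp_le)
      then show ?thesis by (simp add: algebra_simps)
    qed
    then have "(\<Sum>(x, y)\<in>edges_at A. sqrt (G x) * sqrt (G y) * ((f x - g x) - (f y - g y))\<^sup>2)
      \<le> (\<Sum>(x, y)\<in>edges_at A. 2 * (sqrt (G x) * sqrt (G y) * (f x - f y)\<^sup>2)
          + 2 * (sqrt (G x) * sqrt (G y) * (g x - g y)\<^sup>2))"
      by (intro sum_mono) auto
    then show ?thesis by (simp add: case_prod_beta sum.distrib sum_distrib_left)
  qed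
  have "l * wform w ?\<phi> \<le> energy adj ?\<phi> - wform w ?\<phi>"
    using finite_subset[OF _ A, of "{x. ?\<phi> x \<noteq> 0}"] supp \<eta>_W
    by (intro ineq[rule_format]) (auto simp: Cc_def)
  also have "\<dots> = ?Q \<eta>" using A supp by (rule form_sqrt_G)
  also have "\<dots> \<le> 2 * ?Q (cutoff (b / 2) b) + 2 * ?Q (cutoff (d / 2) d)"
    unfolding \<eta>_def by (rule Q_diff)
  \<comment> \<open>Both cutoffs have level ratio 2, so the bound is the same however small
    \<open>b\<close> is.\<close>
  also have "\<dots> \<le> 2 * (2 * c / ln 2) + 2 * (2 * c / ln 2)"
  proof -
    have "?Q (cutoff (t / 2) t) \<le> 2 * c / ln 2" if "b \<le> t" for t
    proof -
      have "ln t - ln (t / 2) = ln 2" using that b(1) by (simp add: ln_div)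
      moreover have "{x. t / 2 < G x} \<subseteq> A" using that by (auto simp: A_def)
      ultimately show ?thesis
        using cutoff_form_le[of "t / 2" t A] that b(1) A by simp
    qed
    from this[of b] this[of d] show ?thesis using b(1,2) by simp
  qed
  finally have "l * wform w ?\<phi> \<le> 8 * c / ln 2" by simp
  then have upper: "wform w ?\<phi> \<le> 8 * c / ln 2 / l" using \<open>l > 0\<close> by (simp add: field_simps)
  have "(\<Sum>x\<in>S. G x * w x) \<le> (\<Sum>x\<in>B \<union> (S - B). G x * w x)"
    using S B G_pos w_nonneg by (intro sum_mono2) (auto simp: less_imp_le)
  also have "\<dots> = (\<Sum>x\<in>B. G x * w x) + (\<Sum>x\<in>S - B. G x * w x)"
    using S B by (intro sum.union_disjoint) auto
  also have "(\<Sum>x\<in>S - B. G x * w x) = (\<Sum>x\<in>S - B. w x * (?\<phi> x)\<^sup>2)"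
    using G_pos by (intro sum.cong) (auto simp: \<eta>_S less_imp_le)
  also have "\<dots> \<le> (\<Sum>x\<in>A. w x * (?\<phi> x)\<^sup>2)"
    using A \<eta>_S supp w_nonneg by (intro sum_mono2) force+
  also have "\<dots> = wform w ?\<phi>" using A supp by (simp add: wform_eq_sum[of A])
  finally show False using upper S_large by simp
qed

lemma optimal_hardy_weight: "optimal_hardy_weight adj w"
  using hardy_weight critical null_critical optimal_near_infinity
  by (simp add: optimal_hardy_weight_def)

end

section \<open>The Green function\<close>

lemma step_prob_nonneg: "step_prob adj n x y \<ge> 0"
  by (induction n arbitrary: x) (auto simp: trans_prob_def intro!: sum_nonneg)

text \<open>First-step decomposition: the term for time 0 is split off and the finite neighbour sum
  is exchanged with the series.\<close>

lemma green_eq: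
  assumes "transient adj"
  shows "green adj x y = (if x = y then 1 else 0) + (\<Sum>z\<in>nbrs adj x. trans_prob adj x z * green adj z y)"
proof -
  have s: "summable (\<lambda>n. step_prob adj n x y)" for x using assms by (simp add: transient_def)
  have "green adj x y = step_prob adj 0 x y + (\<Sum>n. step_prob adj (Suc n) x y)"
    unfolding green_def using suminf_split_head[OF s, of x] by simp
  also have "(\<Sum>n. step_prob adj (Suc n) x y) = (\<Sum>z\<in>nbrs adj x. trans_prob adj x z * green adj z y)"
    using s by (simp add: green_def suminf_sum suminf_mult summable_mult)
  finally show ?thesis by simp
qed

lemma laplacian_green:
  assumes "transient adj" and "finite (nbrs adj x)"
  shows "laplacian adj (\<lambda>x. green adj x y) x = (if x = y then real (deg adj x) else 0)"
proof -
  have "real (deg adj x) * (\<Sum>z\<in>nbrs adj x. trans_prob adj x z * green adj z y)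
      = (\<Sum>z\<in>nbrs adj x. green adj z y)"
    using assms(2) unfolding sum_distrib_left
    by (intro sum.cong) (auto simp: trans_prob_def deg_def nbrs_def card_gt_0_iff)
  then show ?thesis
    using green_eq[OF assms(1), of x y]
    by (simp add: laplacian_def sum_subtractf deg_def algebra_simps)
qed

lemma sum_trans_prob_le: "(\<Sum>z\<in>nbrs adj x. trans_prob adj x z) \<le> 1"
proof -
  have "(\<Sum>z\<in>nbrs adj x. trans_prob adj x z) = (\<Sum>z\<in>nbrs adj x. 1 / real (deg adj x))"
    by (rule sum.cong) (auto simp: trans_prob_def nbrs_def)
  then show ?thesis by (simp add: deg_def)
qed

text \<open>Maximum principle for partial sums: from \<open>x \<noteq> y\<close> the time-0 term
  vanishes, so \<open>N + 1\<close> terms at \<open>x\<close> are a substochastic average of sums of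
  \<open>N\<close> terms, each at most the one at \<open>y\<close> by induction.\<close>

lemma green_le_diagonal:
  assumes "transient adj"
  shows "green adj x y \<le> green adj y y"
proof -
  let ?P = "\<lambda>N x. \<Sum>n<N. step_prob adj n x y"
  have s: "summable (\<lambda>n. step_prob adj n x y)" for x using assms by (simp add: transient_def)
  have "?P N x \<le> ?P N y" for N x
  proof (induction N arbitrary: x)
    case (Suc N)
    show ?case
    proof (cases "x = y")
      case False
      have "?P (Suc N) x = (\<Sum>z\<in>nbrs adj x. trans_prob adj x z * ?P N z)"
        using False unfolding sum.lessThan_Suc_shift
        by (simp add: sum_distrib_left) (rule sum.swap)
      also have "\<dots> \<le> (\<Sum>z\<in>nbrs adj x. trans_prob adj x z * ?P N y)"
        by (rule sum_mono, rule mult_left_mono, rule Suc) (simp add: trans_prob_def)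
      also have "\<dots> = (\<Sum>z\<in>nbrs adj x. trans_prob adj x z) * ?P N y"
        by (simp add: sum_distrib_right)
      also have "\<dots> \<le> 1 * ?P N y"
        by (intro mult_right_mono sum_trans_prob_le sum_nonneg step_prob_nonneg)
      also have "\<dots> \<le> ?P (Suc N) y" by (simp add: step_prob_nonneg)
      finally show ?thesis .
    qed simp
  qed simp
  then show ?thesis
    unfolding green_def by (intro LIMSEQ_le[OF summable_LIMSEQ[OF s] summable_LIMSEQ[OF s]]) auto
qed

lemma green_nonneg:
  assumes "transient adj"
  shows "green adj x y \<ge> 0"
  unfolding green_def using assms by (intro suminf_nonneg step_prob_nonneg) (simp add: transient_def)

text \<open>Harnack inequality for neighbours: all but one term of the first-step decomposition are
  dropped.\<close>

lemma green_ge_neighbour: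
  assumes "transient adj" and "finite (nbrs adj x)" and "adj x z"
  shows "green adj z y \<le> real (deg adj x) * green adj x y"
proof -
  have z: "z \<in> nbrs adj x" using assms(3) by (simp add: nbrs_def)
  then have deg: "real (deg adj x) > 0" using assms(2) by (auto simp: deg_def card_gt_0_iff)
  have "trans_prob adj x z * green adj z y \<le> (\<Sum>z\<in>nbrs adj x. trans_prob adj x z * green adj z y)"
    using z assms green_nonneg[OF assms(1)]
    by (intro member_le_sum[where f = "\<lambda>z. trans_prob adj x z * green adj z y"])
      (auto simp: trans_prob_def)
  also have "\<dots> \<le> green adj x y" using green_eq[OF assms(1), of x y] by simp
  finally show ?thesis using deg assms(3) by (simp add: trans_prob_def field_simps)
qed

text \<open>The diagonal is at least 1 by the time-0 term, and the neighbour inequality carries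
  positivity back along a path.\<close>

lemma green_pos:
  assumes "transient adj" and "connected_graph adj" and "\<And>x. finite (nbrs adj x)"
  shows "green adj x y > 0"
proof -
  have "adj\<^sup>*\<^sup>* x y" using assms(2) by (simp add: connected_graph_def)
  then show ?thesis
  proof (induction rule: converse_rtranclp_induct)
    case base
    have "0 \<le> (\<Sum>z\<in>nbrs adj y. trans_prob adj y z * green adj z y)"
      using green_nonneg[OF assms(1)] by (intro sum_nonneg) (auto simp: trans_prob_def)
    then show ?case using green_eq[OF assms(1), of y y] by simp
  next
    case (step x z)
    then have "0 < real (deg adj x) * green adj x y"
      using green_ge_neighbour[OF assms(1,3) step.hyps(1), of y] by linarith
    then show ?case by (simp add: zero_less_mult_iff)
  qed
qed

theorem theorem0p2:
  fixes adj :: "'a \<Rightarrow> 'a \<Rightarrow> bool" and x\<^sub>0 :: 'a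
    and G w :: "'a \<Rightarrow> real"
  assumes "countable (UNIV :: 'a set)" and "infinite (UNIV :: 'a set)"
    and "simple_graph adj" and "connected_graph adj" and "bounded_degree adj"
    and "transient adj"
    and G: "\<And>x. G x = green adj x x\<^sub>0"
    and "proper_pos G"
    and w: "\<And>x. w x = laplacian adj (\<lambda>y. sqrt (G y)) x / sqrt (G x)"
  shows "(\<forall>\<phi>\<in>Cc UNIV. energy adj \<phi> \<ge> (\<Sum>\<^sub>\<infinity>x\<in>UNIV. w x * (\<phi> x)\<^sup>2))
    \<and> optimal_hardy_weight adj w
    \<and> (\<forall>x. x \<noteq> x\<^sub>0 \<longrightarrow>
         w x = 1 / (2 * G x) * (\<Sum>y\<in>nbrs adj x. (sqrt (G x) - sqrt (G y))\<^sup>2))"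
proof -
  obtain D where fin: "\<And>x. finite (nbrs adj x)" and D: "\<And>x. deg adj x \<le> D"
    using assms(5) by (auto simp: bounded_degree_def)
  have G_eq: "G = (\<lambda>x. green adj x x\<^sub>0)" using G by auto
  have G_pos: "G x > 0" for x using green_pos[OF assms(6,4) fin] G by simp
  have deg_pos: "deg adj x\<^sub>0 > 0"
  proof -
    obtain y where "y \<noteq> x\<^sub>0" using assms(2) by (metis finite.emptyI finite_insert ex_new_if_finite insertI1)
    moreover have "adj\<^sup>*\<^sup>* x\<^sub>0 y" using assms(4) by (simp add: connected_graph_def)
    ultimately obtain z where "adj x\<^sub>0 z" by (metis converse_rtranclpE)
    then show ?thesis using fin by (auto simp: deg_def card_gt_0_iff nbrs_def)
  qed
  interpret proper_harmonic_off_pole adj G x\<^sub>0 "real (deg adj x\<^sub>0)" "real D"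
  proof
    show "symp adj" using assms(3) by (simp add: simple_graph_def)
    show "laplacian adj G x = (if x = x\<^sub>0 then real (deg adj x\<^sub>0) else 0)" for x
      unfolding G_eq using laplacian_green[OF assms(6) fin, of x\<^sub>0 x] by simp
    show "finite {x. a < G x}" if "a > 0" for a
    \<comment> \<open>Properness speaks only of compact sets; the maximum of \<open>G\<close> at the
      pole supplies the upper end of the interval.\<close>
    proof (rule finite_subset)
      show "{x. a < G x} \<subseteq> G -` {a..G x\<^sub>0}" using green_le_diagonal[OF assms(6)] G by auto
      have "compact {a..G x\<^sub>0}" "{a..G x\<^sub>0} \<subseteq> {0<..}" using that by auto
      then show "finite (G -` {a..G x\<^sub>0})" using assms(8) unfolding proper_pos_def by blast
    qed
    show "G y \<le> real D * G x" if "adj x y" for x y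
    proof -
      have "G y \<le> real (deg adj x) * G x" unfolding G_eq using green_ge_neighbour[OF assms(6) fin that] .
      also have "\<dots> \<le> real D * G x" using D G_pos by (intro mult_right_mono) (auto simp: less_imp_le)
      finally show ?thesis .
    qed
  qed (use assms(4) fin G_pos deg_pos in auto)
  \<comment> \<open>Identifies the weight fixed in the theorem with the constant \<open>w\<close> of
    the locale.\<close>
  have w_eq: "w = proper_harmonic_off_pole.w adj G"
    using w by (auto simp: w_def)
  have "w x = 1 / (2 * G x) * (\<Sum>y\<in>nbrs adj x. (sqrt (G x) - sqrt (G y))\<^sup>2)" if "x \<noteq> x\<^sub>0" for x
    using G_mult_w[of x] that G_pos[of x] by (simp add: w_eq field_simps)
  then show ?thesis
    using form_nonneg optimal_hardy_weight by (auto simp: w_eq wform_def)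
qed

end
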